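(* As $n \to \infty$ through the positive integers, $$\Big(\tfrac{1}{16} - o(1)\Big)\frac{(\log n)^2}{(\log\log n)^2} \;\le\; \dim_2\big(\mathcal{D}_{[n]}\big) \;\le\; \Big(\tfrac{4}{3}e\pi^2 + o(1)\Big)\frac{(\log n)^2}{\log\log n},$$ where $\mathcal{D}_{[n]}$ is the poset on $[n]=\{1,\dots,n\}$ ordered by divisibility and $\dim_2$ is the $2$-dimension.
   Context: $[n] = \{1,\dots,n\}$, and for $S\subseteq\mathbb{N}$, $\mathcal{D}_S$ denotes the set $S$ partially ordered by divisibility ($a \le b$ iff $a \mid b$). A poset embedding $P \hookrightarrow Q$ is a map $\varphi$ with $\varphi(a)\le_Q\varphi(b)$ if and only if $a\le_P b$. The $2$-dimension $\dim_2(P)$ of a finite poset $P$ is the minimum $d$ such that $P$ embeds into the poset of all subsets of $[d]$ ordered by inclusion; equivalently, the minimum $d$ such that $P$ embeds into a product of $d$ linear orders each of cardinality at most $2$. $\log$ is the natural logarithm. Each $o(1)$ denotes a function of $n$ tending to $0$ as $n\to\infty$. *)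

theory Defs
  imports Complex_Main
begin

text \<open>
  A poset is given by its carrier \<open>A\<close> and an order predicate \<open>le\<close>, of which only the
  restriction to \<open>A\<close> matters. A poset embedding preserves and reflects the order;
  injectivity on \<open>A\<close> then follows from reflexivity in the target and antisymmetry of \<open>le\<close> on \<open>A\<close>.
\<close>

definition poset_embedding ::
  "'a set \<Rightarrow> ('a \<Rightarrow> 'a \<Rightarrow> bool) \<Rightarrow> 'b set \<Rightarrow> ('b \<Rightarrow> 'b \<Rightarrow> bool) \<Rightarrow> ('a \<Rightarrow> 'b) \<Rightarrow> bool" where
  "poset_embedding A leA B leB \<phi> \<longleftrightarrow>
     \<phi> ` A \<subseteq> B \<and> (\<forall>a\<in>A. \<forall>b\<in>A. leB (\<phi> a) (\<phi> b) \<longleftrightarrow> leA a b)"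

text \<open>
  The minimum is over a nonempty set of candidates whenever the poset is finite
  (see \<open>two_dim_attained\<close>). The value for infinite posets carries no meaning.
\<close>

definition two_dim :: "'a set \<Rightarrow> ('a \<Rightarrow> 'a \<Rightarrow> bool) \<Rightarrow> nat" where
  "two_dim A le = (LEAST d. \<exists>\<phi>. poset_embedding A le (Pow {1..d::nat}) (\<subseteq>) \<phi>)"

lemma two_dim_attained:
  assumes "finite A" and refl: "\<And>a. a \<in> A \<Longrightarrow> le a a"
    and trans: "\<And>a b c. a \<in> A \<Longrightarrow> b \<in> A \<Longrightarrow> c \<in> A \<Longrightarrow> le a b \<Longrightarrow> le b c \<Longrightarrow> le a c"
  shows "\<exists>\<phi>. poset_embedding A le (Pow {1..two_dim A le}) (\<subseteq>) \<phi>"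
proof -
  obtain h where h: "bij_betw h A {1..card A}"
    using \<open>finite A\<close> by (metis card_atLeastAtMost diff_Suc_1 finite_atLeastAtMost finite_same_card_bij)
  define \<phi> where "\<phi> a = h ` {x \<in> A. le x a}" for a
  have "\<phi> a \<subseteq> \<phi> b \<longleftrightarrow> le a b" if "a \<in> A" "b \<in> A" for a b
  proof -
    have "\<phi> a \<subseteq> \<phi> b \<longleftrightarrow> {x \<in> A. le x a} \<subseteq> {x \<in> A. le x b}"
      unfolding \<phi>_def using bij_betw_imp_inj_on[OF h]
      by (auto simp: inj_on_def image_subset_iff image_iff) blast
    also have "\<dots> \<longleftrightarrow> le a b"
      using that refl trans by blast
    finally show ?thesis .
  qed
  moreover have "\<phi> ` A \<subseteq> Pow {1..card A}"
    using bij_betw_imp_surj_on[OF h] unfolding \<phi>_def by blast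
  ultimately have "\<exists>\<phi>. poset_embedding A le (Pow {1..card A}) (\<subseteq>) \<phi>"
    unfolding poset_embedding_def by blast
  then show ?thesis
    unfolding two_dim_def by (rule LeastI)
qed

end

theory Submission
  imports Defs "HOL-Number_Theory.Prime_Powers" "HOL-Library.FuncSet" "HOL-Real_Asymp.Real_Asymp"
begin

text \<open>
  Write \<open>L\<close> for \<open>ln n\<close>. Both bounds reformulate an embedding into subsets of \<open>[d]\<close> as a question
  about separating one prime (power) from the prime (powers) dividing a number.

  Lower bound. Let \<open>\<phi>\<close> be an embedding. If \<open>B\<close> is a set of at most \<open>r\<close> primes whose product is
  at most \<open>n\<close>, and \<open>p\<close> is a prime outside \<open>B\<close>, then \<open>\<phi> p\<close> is not contained in \<open>\<phi> (\<Prod>B)\<close>, hence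
  not in the union of the \<open>\<phi> b\<close> with \<open>b \<in> B\<close>. So the sets \<open>\<phi> p\<close> form an \<open>r\<close>-cover-free family,
  and such a family of \<open>m\<close> sets needs at least \<open>min m ((r + 2) choose 2)\<close> points
  (\<open>card_ge_cover_free\<close>). Taking the primes up to \<open>L\<^sup>2\<close> allows \<open>r\<close> to be about \<open>L / (2 ln L)\<close>, and
  then the binomial coefficient is about \<open>L\<^sup>2 / (8 (ln L)\<^sup>2)\<close>. By Chebyshev's estimate
  (\<open>card_primes_ge\<close>) there are more than that many primes, so the binomial coefficient is what
  counts.

  Upper bound. If \<open>a\<close> does not divide \<open>b\<close>, some prime power \<open>q\<close> divides \<open>a\<close> but not \<open>b\<close>. The
  powers of primes up to \<open>sqrt L\<close> are few, and each gets a coordinate of its own. Every \<open>b \<le> n\<close>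
  is divisible by at most \<open>r = 2 L / ln L\<close> powers of primes above \<open>sqrt L\<close>. In a random colouring
  of these prime powers with \<open>2 r\<close> colours, the colour of \<open>q\<close> avoids all colours seen in \<open>b\<close>
  with probability at least one half, by the union bound. As there are at most \<open>n\<^sup>2\<close> pairs
  \<open>(q, b)\<close>, some \<open>t \<approx> 2 L / ln 2\<close> colourings separate all of them
  (\<open>exists_separating_colourings\<close>). Recording for each number which colours its prime powers
  take in each colouring uses \<open>2 r t\<close> coordinates, about \<open>(8 / ln 2) L\<^sup>2 / ln L\<close>.

  The constants \<open>1/8\<close> and \<open>8 / ln 2\<close> (less than \<open>12\<close>) leave room on both sides, since
  \<open>4/3 e \<pi>\<^sup>2\<close> exceeds \<open>24\<close>. Hence the bounds hold eventually with both error terms equal to zero.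
\<close>

section \<open>Cover-free families\<close>

text \<open>
  If every set has a point that lies in no other set, these points are distinct and there are at
  least as many of them as sets. Otherwise some \<open>F x\<close> is covered by other sets, one for each of
  its points, so it has at least \<open>r + 2\<close> points in the induction step. Deleting \<open>x\<close> and the
  points of \<open>F x\<close> leaves a family that is cover-free with parameter one less, because \<open>x\<close> may be
  added to any cover. The lower bounds for the deleted sets add up to the binomial coefficient.
\<close>

lemma card_ge_cover_free:
  fixes F :: "'a \<Rightarrow> 'b set"
  assumes "finite X" "finite D" "\<And>x. x \<in> X \<Longrightarrow> F x \<subseteq> D"
    and "\<And>x B. x \<in> X \<Longrightarrow> B \<subseteq> X - {x} \<Longrightarrow> card B \<le> r \<Longrightarrow> \<not> F x \<subseteq> (\<Union>y\<in>B. F y)"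
  shows "min (card X) ((r + 2) choose 2) \<le> card D"
  using assms
proof (induction r arbitrary: X D F)
  case 0
  show ?case
  proof (cases "X = {}")
    case False
    then obtain x where "x \<in> X" by blast
    then have "F x \<noteq> {}" using 0(4)[of x "{}"] by simp
    then have "D \<noteq> {}" using 0(3) \<open>x \<in> X\<close> by blast
    then have "card D \<ge> 1" using 0(2) by (simp add: Suc_leI card_gt_0_iff)
    then show ?thesis by (simp add: numeral_2_eq_2)
  qed simp
next
  case (Suc r)
  show ?case
  proof (cases "\<forall>x\<in>X. \<exists>c\<in>F x. \<forall>y\<in>X - {x}. c \<notin> F y")
    case True
    then obtain c where c: "\<And>x. x \<in> X \<Longrightarrow> c x \<in> F x"
      "\<And>x y. x \<in> X \<Longrightarrow> y \<in> X \<Longrightarrow> y \<noteq> x \<Longrightarrow> c x \<notin> F y"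
      by (metis DiffI singletonD)
    have "inj_on c X" using c by (metis inj_onI)
    moreover have "c ` X \<subseteq> D" using c(1) Suc.prems(3) by blast
    ultimately have "card X \<le> card D" using Suc.prems(2) by (metis card_inj_on_le)
    then show ?thesis by simp
  next
    case False
    then obtain x where x: "x \<in> X" "\<And>c. c \<in> F x \<Longrightarrow> \<exists>y\<in>X - {x}. c \<in> F y" by blast
    then obtain y where y: "\<And>c. c \<in> F x \<Longrightarrow> y c \<in> X - {x} \<and> c \<in> F (y c)" by metis
    have finF: "finite (F x)" using Suc.prems(2,3) x(1) finite_subset by blast
    have "F x \<subseteq> (\<Union>z\<in>y ` F x. F z)" using y by blast
    then have "\<not> card (y ` F x) \<le> Suc r"
      using Suc.prems(4)[of x "y ` F x"] x(1) y by blast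
    then have big: "r + 2 \<le> card (F x)" using card_image_le[OF finF, of y] by simp
    have "min (card (X - {x})) ((r + 2) choose 2) \<le> card (D - F x)"
    proof (rule Suc.IH[where F = "\<lambda>y. F y - F x"])
      fix z B assume z: "z \<in> X - {x}" "B \<subseteq> X - {x} - {z}" "card B \<le> r"
      then have "finite B" using Suc.prems(1) by (meson finite_Diff finite_subset)
      then have "card (insert x B) \<le> Suc r" using z(3) by (simp add: card_insert_if)
      moreover have "insert x B \<subseteq> X - {z}" using z x(1) by blast
      ultimately have "\<not> F z \<subseteq> (\<Union>y\<in>insert x B. F y)" using Suc.prems(4) z(1) by blast
      then show "\<not> F z - F x \<subseteq> (\<Union>y\<in>B. F y - F x)" by blast
    qed (use Suc.prems(1-3) in auto)
    moreover have "card (D - F x) + card (F x) = card D"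
      using Suc.prems(2,3) x(1) finF by (metis card_Diff_subset card_mono le_add_diff_inverse2)
    moreover have "card (X - {x}) + 1 = card X"
      using x(1) Suc.prems(1) by (metis Suc_eq_plus1 card_Suc_Diff1)
    moreover have "(Suc r + 2) choose 2 = (r + 2) + ((r + 2) choose 2)"
      by (simp add: numeral_2_eq_2)
    ultimately show ?thesis using big by linarith
  qed
qed

section \<open>Chebyshev's lower bound for the number of primes\<close>

text \<open>
  This is the sum of \<open>ln m = (\<Sum>d | d dvd m. mangoldt d)\<close> over \<open>m \<le> n\<close>. The range of \<open>d\<close> may
  extend beyond \<open>n\<close>, where the terms vanish, so that the formulas for \<open>(2 m)!\<close> and \<open>m!\<close> can be
  subtracted termwise.
\<close>

lemma ln_fact_eq_sum_mangoldt:
  assumes "n \<le> N"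
  shows "ln (fact n) = (\<Sum>d\<in>{1..N}. mangoldt d * real (n div d))"
proof -
  have "ln (fact n) = (\<Sum>m\<in>{1..n}. ln (real m))"
    unfolding fact_prod of_nat_prod by (subst ln_prod) auto
  also have "\<dots> = (\<Sum>m\<in>{1..n}. \<Sum>d\<in>{d\<in>{1..N}. d dvd m}. mangoldt d)"
  proof (rule sum.cong[OF refl])
    fix m assume m: "m \<in> {1..n}"
    then have "{d\<in>{1..N}. d dvd m} = {d. d dvd m}"
      using assms by (auto dest: dvd_imp_le intro: Nat.gr0I)
    then show "ln (real m) = (\<Sum>d\<in>{d\<in>{1..N}. d dvd m}. mangoldt d)"
      using mangoldt_sum[of m, where ?'a = real] m by simp
  qed
  also have "\<dots> = (\<Sum>d\<in>{1..N}. \<Sum>m\<in>{m\<in>{1..n}. d dvd m}. mangoldt d)"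
    by (rule sum.swap_restrict) auto
  also have "\<dots> = (\<Sum>d\<in>{1..N}. mangoldt d * real (n div d))"
  proof (rule sum.cong[OF refl])
    fix d assume d: "d \<in> {1..N}"
    then have "{m\<in>{1..n}. d dvd m} = (\<lambda>k. d * k) ` {1..n div d}"
      by (auto elim!: dvdE simp: less_eq_div_iff_mult_less_eq mult.commute)
    moreover have "inj_on (\<lambda>k. d * k) {1..n div d}" using d by (auto simp: inj_on_def)
    ultimately show "(\<Sum>m\<in>{m\<in>{1..n}. d dvd m}. mangoldt d) = mangoldt d * real (n div d)"
      by (simp add: card_image)
  qed
  finally show ?thesis .
qed

text \<open>
  Every prime power up to \<open>x\<close> divides the product \<open>N\<close> of the largest powers \<open>p ^ K p \<le> x\<close>, so the
  sum is at most \<open>ln N\<close>, and each prime contributes at most \<open>ln x\<close> to that logarithm.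
\<close>

lemma sum_mangoldt_le:
  assumes "x \<ge> 1"
  shows "(\<Sum>d\<in>{1..x}. mangoldt d) \<le> real (card {p. prime p \<and> p \<le> x}) * ln (real x)"
proof -
  let ?P = "{p::nat. prime p \<and> p \<le> x}"
  have "\<exists>K. p ^ K \<le> x \<and> x < p ^ (K + 1)" if "p \<in> ?P" for p
    using ex_power_ivl1[of p x] that assms prime_ge_2_nat by auto
  then obtain K where K: "\<And>p. p \<in> ?P \<Longrightarrow> p ^ K p \<le> x \<and> x < p ^ (K p + 1)" by metis
  define N where "N = (\<Prod>p\<in>?P. p ^ K p)"
  have fin: "finite ?P" by (rule finite_subset[of _ "{..x}"]) auto
  have N: "N > 0" unfolding N_def by (rule prod_pos) (auto simp: prime_gt_0_nat)
  have "(\<Sum>d\<in>{1..x}. mangoldt d) = (\<Sum>d\<in>{d\<in>{1..x}. primepow d}. mangoldt d :: real)"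
    by (rule sum.mono_neutral_right) (auto simp: mangoldt_def)
  also have "\<dots> \<le> (\<Sum>d | d dvd N. mangoldt d)"
  proof (rule sum_mono2)
    show "{d\<in>{1..x}. primepow d} \<subseteq> {d. d dvd N}"
    proof safe
      fix d assume d: "d \<in> {1..x}" "primepow d"
      then obtain p k where pk: "prime p" "k > 0" "d = p ^ k" by (auto simp: primepow_def)
      have "p \<le> p ^ k" using pk by (simp add: prime_gt_0_nat self_le_power Suc_leI)
      then have p: "p \<in> ?P" using d pk by auto
      have "p ^ k < p ^ (K p + 1)" using K[OF p] d pk by auto
      then have "k \<le> K p" using pk(1) prime_gt_1_nat[of p] power_less_imp_less_exp[of p k "K p + 1"] by simp
      then have "d dvd p ^ K p" unfolding pk(3) by (rule le_imp_power_dvd)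
      also have "\<dots> dvd N" unfolding N_def using fin p by (rule dvd_prodI)
      finally show "d dvd N" .
    qed
  qed (use N in \<open>auto simp: mangoldt_nonneg\<close>)
  also have "\<dots> = ln (real N)" using mangoldt_sum[of N, where ?'a = real] N by simp
  also have "\<dots> = (\<Sum>p\<in>?P. ln (real (p ^ K p)))"
    unfolding N_def of_nat_prod by (subst ln_prod) (auto simp: fin prime_gt_0_nat)
  also have "\<dots> \<le> (\<Sum>p\<in>?P. ln (real x))"
  proof (rule sum_mono)
    fix p assume p: "p \<in> ?P"
    then have "0 < p ^ K p" "p ^ K p \<le> x" using K prime_gt_0_nat by auto
    then show "ln (real (p ^ K p)) \<le> ln (real x)"
      using assms by (subst ln_le_cancel_iff) (auto simp del: of_nat_power)
  qed
  finally show ?thesis by simp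
qed

text \<open>
  The central binomial coefficient is at least \<open>4 ^ m / (2 m)\<close>. In its logarithm, the
  coefficient of \<open>mangoldt d\<close> is \<open>2 m div d - 2 (m div d) \<le> 1\<close>.
\<close>

lemma card_primes_ge:
  assumes "m \<ge> 1"
  shows "real m * ln 4 \<le> (real (card {p. prime p \<and> p \<le> 2 * m}) + 1) * ln (real (2 * m))"
proof -
  have "real m * ln 4 - ln (real (2 * m)) = ln (4 ^ m / (2 * real m))"
    using assms by (simp add: ln_div ln_realpow)
  also have "\<dots> \<le> ln (real ((2 * m) choose m))"
    using assms central_binomial_lower_bound[of m] by (subst ln_le_cancel_iff) auto
  also have "real ((2 * m) choose m) = fact (2 * m) / (fact m * fact m)"
    by (simp add: binomial_fact)
  also have "ln \<dots> = ln (fact (2 * m)) - (ln (fact m) + ln (fact m))"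
    by (simp add: ln_div ln_mult)
  also have "\<dots> = (\<Sum>d\<in>{1..2*m}. mangoldt d * (real (2 * m div d) - 2 * real (m div d)))"
    by (simp add: ln_fact_eq_sum_mangoldt[of _ "2 * m"] sum_subtractf algebra_simps sum_distrib_left)
  also have "\<dots> \<le> (\<Sum>d\<in>{1..2*m}. mangoldt d * 1)"
  proof (intro sum_mono mult_left_mono mangoldt_nonneg)
    fix d assume "d \<in> {1..2*m}"
    then have d: "d > 0" by simp
    then have "m < (m div d + 1) * d" by (simp add: dividend_less_div_times)
    then have "2 * m < (2 * (m div d) + 2) * d" by (simp add: algebra_simps)
    then have "2 * m div d < 2 * (m div d) + 2" using d by (simp add: div_less_iff_less_mult)
    then show "real (2 * m div d) - 2 * real (m div d) \<le> 1" by linarith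
  qed
  also have "\<dots> \<le> real (card {p. prime p \<and> p \<le> 2 * m}) * ln (real (2 * m))"
    using sum_mangoldt_le[of "2 * m"] assms by simp
  finally show ?thesis by (simp add: algebra_simps)
qed

section \<open>The lower bound\<close>

lemma two_dim_divisibility_ge:
  fixes n x r :: nat
  assumes "x ^ r \<le> n" "x \<le> n"
  shows "min (card {p. prime p \<and> p \<le> x}) ((r + 2) choose 2) \<le> two_dim {1..n} ((dvd) :: nat \<Rightarrow> nat \<Rightarrow> bool)"
proof -
  let ?P = "{p::nat. prime p \<and> p \<le> x}"
  let ?D = "{1..two_dim {1..n} ((dvd) :: nat \<Rightarrow> nat \<Rightarrow> bool)}"
  obtain \<phi> where "poset_embedding {1..n} ((dvd) :: nat \<Rightarrow> nat \<Rightarrow> bool) (Pow ?D) (\<subseteq>) \<phi>"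
    using two_dim_attained[of "{1..n}" "(dvd) :: nat \<Rightarrow> nat \<Rightarrow> bool"] dvd_trans by (metis dvd_refl finite_atLeastAtMost)
  then have \<phi>: "\<And>a. a \<in> {1..n} \<Longrightarrow> \<phi> a \<subseteq> ?D"
    "\<And>a b. a \<in> {1..n} \<Longrightarrow> b \<in> {1..n} \<Longrightarrow> \<phi> a \<subseteq> \<phi> b \<longleftrightarrow> a dvd b"
    unfolding poset_embedding_def by blast+
  have P: "p \<in> {1..n}" if "p \<in> ?P" for p
    using that assms(2) prime_gt_0_nat[of p] by auto
  have "min (card ?P) ((r + 2) choose 2) \<le> card ?D"
  proof (rule card_ge_cover_free[where F = \<phi>])
    fix p B assume p: "p \<in> ?P" and B: "B \<subseteq> ?P - {p}" "card B \<le> r"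
    have finB: "finite B" by (rule finite_subset[of _ "{..x}"]) (use B in auto)
    have x: "x \<ge> 1" using p prime_gt_0_nat[of p] by auto
    have "\<Prod>B \<le> (\<Prod>b\<in>B. x)" by (rule prod_mono) (use B in auto)
    also have "\<dots> \<le> x ^ r" using B(2) x by (simp add: power_increasing)
    finally have "\<Prod>B \<le> n" using assms(1) by simp
    moreover have "\<Prod>B > 0" by (rule prod_pos) (use B in \<open>auto simp: prime_gt_0_nat\<close>)
    ultimately have prodB: "\<Prod>B \<in> {1..n}" by simp
    have "(\<Union>b\<in>B. \<phi> b) \<subseteq> \<phi> (\<Prod>B)"
    proof (rule UN_least)
      fix b assume "b \<in> B"
      then show "\<phi> b \<subseteq> \<phi> (\<Prod>B)"
        using \<phi>(2)[OF P prodB, of b] B(1) dvd_prodI[OF finB, of b "\<lambda>b. b"] by auto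
    qed
    moreover have "\<not> p dvd \<Prod>B"
    proof
      assume "p dvd \<Prod>B"
      then obtain b where "b \<in> B" "p dvd b"
        using p finB by (auto simp: prime_dvd_prod_iff)
      then show False using B(1) p primes_dvd_imp_eq[of p b] by auto
    qed
    ultimately show "\<not> \<phi> p \<subseteq> (\<Union>b\<in>B. \<phi> b)"
      using \<phi>(2)[OF P[OF p] prodB] by blast
  qed (use \<phi>(1) P in \<open>auto intro: finite_subset[of _ "{..x}"]\<close>)
  then show ?thesis by simp
qed

section \<open>Random colourings\<close>

text \<open>
  By averaging, some \<open>f\<close> in \<open>T\<close> is good for at least half of \<open>X\<close>. The rest is handled by
  induction on \<open>t\<close>, until fewer than \<open>2 ^ 0\<close> elements remain.
\<close>

lemma exists_halving_sequence:
  fixes X :: "'a set" and T :: "'b set"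
  assumes "finite T" "finite X" "card X < 2 ^ t"
    and half: "\<And>x. x \<in> X \<Longrightarrow> 2 * card {f\<in>T. \<not> good f x} \<le> card T" and "T \<noteq> {}"
  shows "\<exists>g. (\<forall>i<t. g i \<in> T) \<and> (\<forall>x\<in>X. \<exists>i<t. good (g i) x)"
  using assms(2-4)
proof (induction t arbitrary: X)
  case (Suc t)
  have "\<exists>f\<in>T. 2 * card {x\<in>X. \<not> good f x} \<le> card X"
  proof (rule ccontr)
    assume "\<not> ?thesis"
    then have "(\<Sum>f\<in>T. card X) < (\<Sum>f\<in>T. 2 * card {x\<in>X. \<not> good f x})"
      by (intro sum_strict_mono assms) (auto simp: not_le)
    \<comment> \<open>double counting of the pairs \<open>(f, x)\<close> for which \<open>f\<close> is not good\<close>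
    also have "\<dots> = 2 * (\<Sum>f\<in>T. \<Sum>x\<in>{x\<in>X. \<not> good f x}. 1)"
      by (simp add: sum_distrib_left)
    also have "\<dots> = 2 * (\<Sum>x\<in>X. \<Sum>f\<in>{f\<in>T. \<not> good f x}. 1)"
      by (subst sum.swap_restrict[OF assms(1) Suc.prems(1)]) simp
    also have "\<dots> \<le> (\<Sum>x\<in>X. card T)"
      unfolding sum_distrib_left by (rule sum_mono) (use Suc.prems(3) in \<open>simp add: mult.commute\<close>)
    finally show False by (simp add: mult.commute)
  qed
  then obtain f where f: "f \<in> T" "2 * card {x\<in>X. \<not> good f x} \<le> card X" by blast
  have "\<exists>g. (\<forall>i<t. g i \<in> T) \<and> (\<forall>x\<in>{x\<in>X. \<not> good f x}. \<exists>i<t. good (g i) x)"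
    by (rule Suc.IH) (use Suc.prems f in auto)
  then obtain g where g: "\<forall>i<t. g i \<in> T" "\<forall>x\<in>{x\<in>X. \<not> good f x}. \<exists>i<t. good (g i) x" by blast
  show ?case
    by (rule exI[of _ "g(t := f)"]) (use f g in \<open>auto simp: less_Suc_eq\<close>)
qed auto

text \<open>
  For fixed \<open>s \<noteq> q\<close>, exactly one in \<open>2 r\<close> of all colourings gives \<open>q\<close> and \<open>s\<close> the same colour. As
  \<open>S\<close> has at most \<open>r\<close> elements, at most half of the colourings repeat the colour of \<open>q\<close> on \<open>S\<close>.
\<close>

lemma exists_separating_colourings:
  fixes Q :: "'a set" and X :: "('a \<times> 'a set) set"
  assumes "finite Q" "finite X" "card X < 2 ^ t" "r \<ge> 1"
    and X: "\<And>q S. (q, S) \<in> X \<Longrightarrow> q \<in> Q \<and> S \<subseteq> Q - {q} \<and> card S \<le> r"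
  shows "\<exists>g. (\<forall>i<t. g i \<in> Q \<rightarrow> {..<2 * r}) \<and> (\<forall>(q, S)\<in>X. \<exists>i<t. g i q \<notin> g i ` S)"
proof -
  define T where "T = (Q \<rightarrow>\<^sub>E {..<2 * r})"
  have cardT: "card T = (2 * r) ^ card Q" unfolding T_def using assms(1) by (simp add: card_PiE)
  have finT: "finite T" unfolding T_def using assms(1) by (simp add: finite_PiE)
  have "\<exists>g. (\<forall>i<t. g i \<in> T) \<and> (\<forall>x\<in>X. \<exists>i<t. (\<lambda>f (q, S). f q \<notin> f ` S) (g i) x)"
  proof (rule exists_halving_sequence[OF finT assms(2,3)])
    show "T \<noteq> {}" using cardT assms(4) by auto
    fix x assume "x \<in> X"
    obtain q S where x: "x = (q, S)" by force
    then have q: "q \<in> Q" "S \<subseteq> Q - {q}" "card S \<le> r" using X \<open>x \<in> X\<close> by auto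
    have finS: "finite S" using q(2) assms(1) by (meson finite_Diff finite_subset)
    have eq: "card {f\<in>T. f q = f s} \<le> (2 * r) ^ (card Q - 1)" if "s \<in> S" for s
    proof -
      have s: "s \<in> Q" "s \<noteq> q" using that q by auto
      \<comment> \<open>such a colouring is determined by its values away from \<open>q\<close>\<close>
      have "card {f\<in>T. f q = f s} \<le> card ((Q - {q}) \<rightarrow>\<^sub>E {..<2 * r})"
      proof (rule card_inj_on_le[where f = "\<lambda>f. restrict f (Q - {q})"])
        show "inj_on (\<lambda>f. restrict f (Q - {q})) {f\<in>T. f q = f s}"
        proof (rule inj_onI)
          fix f h assume fh: "f \<in> {f\<in>T. f q = f s}" "h \<in> {f\<in>T. f q = f s}"
            "restrict f (Q - {q}) = restrict h (Q - {q})"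
          have e: "f z = h z" if "z \<in> Q - {q}" for z using fun_cong[OF fh(3), of z] that by simp
          have "f z = h z" if "z \<in> Q" for z
            using e[of z] e[of s] s fh(1,2) that by (cases "z = q") auto
          then show "f = h" using fh(1,2) unfolding T_def by (auto intro: PiE_ext)
        qed
        show "(\<lambda>f. restrict f (Q - {q})) ` {f\<in>T. f q = f s} \<subseteq> (Q - {q}) \<rightarrow>\<^sub>E {..<2 * r}"
          unfolding T_def by (auto simp: restrict_PiE_iff PiE_mem split: if_splits)
      qed (use assms(1) in \<open>simp add: finite_PiE\<close>)
      also have "\<dots> = (2 * r) ^ (card Q - 1)" using assms(1) q(1) by (simp add: card_PiE)
      finally show ?thesis .
    qed
    have "{f\<in>T. \<not> f q \<notin> f ` S} = (\<Union>s\<in>S. {f\<in>T. f q = f s})" by blast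
    then have "card {f\<in>T. \<not> f q \<notin> f ` S} \<le> (\<Sum>s\<in>S. card {f\<in>T. f q = f s})"
      using card_UN_le[OF finS] by simp
    also have "\<dots> \<le> card S * (2 * r) ^ (card Q - 1)"
      using sum_bounded_above[of S "\<lambda>s. card {f\<in>T. f q = f s}"] eq by simp
    also have "\<dots> \<le> r * (2 * r) ^ (card Q - 1)" using q(3) by simp
    finally have "2 * card {f\<in>T. \<not> f q \<notin> f ` S} \<le> (2 * r) * (2 * r) ^ (card Q - 1)" by simp
    also have "\<dots> = card T"
      unfolding cardT power_Suc[symmetric] using card_Suc_Diff1[OF assms(1) q(1)] q(1) assms(1)
      by (metis card_Diff_singleton)
    finally show "2 * card {f\<in>T. \<not> (\<lambda>(q, S). f q \<notin> f ` S) x} \<le> card T" by (simp add: x)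
  qed
  then obtain g where "\<forall>i<t. g i \<in> T" "\<forall>(q, S)\<in>X. \<exists>i<t. g i q \<notin> g i ` S"
    unfolding case_prod_beta by (elim exE conjE)
  then show ?thesis unfolding T_def PiE_def by (intro exI[of _ g] conjI) simp_all
qed

section \<open>The upper bound\<close>

text \<open>
  This allows coordinates to be indexed by any finite set instead of an initial segment of the
  natural numbers.
\<close>

lemma two_dim_le_card:
  fixes \<psi> :: "'a \<Rightarrow> 'b set"
  assumes "finite I" "poset_embedding A le (Pow I) (\<subseteq>) \<psi>"
  shows "two_dim A le \<le> card I"
proof -
  obtain h where h: "bij_betw h I {1..card I}"
    using \<open>finite I\<close> by (metis card_atLeastAtMost diff_Suc_1 finite_atLeastAtMost finite_same_card_bij)
  have "poset_embedding A le (Pow {1..card I}) (\<subseteq>) (\<lambda>a. h ` \<psi> a)"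
    unfolding poset_embedding_def
  proof (intro conjI ballI)
    have \<psi>: "\<psi> a \<subseteq> I" if "a \<in> A" for a
      using assms(2) that unfolding poset_embedding_def by blast
    show "(\<lambda>a. h ` \<psi> a) ` A \<subseteq> Pow {1..card I}"
    proof (rule image_subsetI, rule PowI)
      fix a assume "a \<in> A"
      then show "h ` \<psi> a \<subseteq> {1..card I}"
        using image_mono[OF \<psi>, of a h] bij_betw_imp_surj_on[OF h] by simp
    qed
    fix a b assume ab: "a \<in> A" "b \<in> A"
    then have "h ` \<psi> a \<subseteq> h ` \<psi> b \<longleftrightarrow> \<psi> a \<subseteq> \<psi> b"
      using inj_on_image_mem_iff[OF bij_betw_imp_inj_on[OF h]] \<psi>
      by (metis image_mono image_subset_iff subsetI subsetD)
    then show "(h ` \<psi> a \<subseteq> h ` \<psi> b) = le a b"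
      using assms(2) ab unfolding poset_embedding_def by simp
  qed
  then show ?thesis unfolding two_dim_def by (blast intro: Least_le)
qed

lemma dvd_iff_primepow_dvd:
  fixes a b :: nat
  assumes "a > 0" "b > 0"
  shows "a dvd b \<longleftrightarrow> (\<forall>q. primepow q \<longrightarrow> q dvd a \<longrightarrow> q dvd b)"
proof
  assume *: "\<forall>q. primepow q \<longrightarrow> q dvd a \<longrightarrow> q dvd b"
  show "a dvd b"
  proof (rule multiplicity_le_imp_dvd)
    fix p :: nat assume p: "prime p"
    have "p ^ multiplicity p a dvd b"
      using * p by (cases "multiplicity p a = 0") (auto simp: multiplicity_dvd)
    then show "multiplicity p a \<le> multiplicity p b"
      using assms p by (intro multiplicity_geI) auto
  qed (use assms in auto)
qed (auto intro: dvd_trans)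

text \<open>There are at most \<open>y\<close> primes, and each exponent is at most the binary logarithm of \<open>n\<close>.\<close>

lemma card_small_primepow_le:
  fixes n :: nat and y :: real
  assumes "n \<ge> 1" "y \<ge> 0"
  shows "real (card {q\<in>{1..n}. primepow q \<and> real (aprimedivisor q) \<le> y}) \<le> y * (ln (real n) / ln 2)"
proof -
  let ?A = "{1..nat \<lfloor>y\<rfloor>}" and ?B = "{1..nat \<lfloor>ln (real n) / ln 2\<rfloor>}"
  have "{q\<in>{1..n}. primepow q \<and> real (aprimedivisor q) \<le> y} \<subseteq> (\<lambda>(p, k). p ^ k) ` (?A \<times> ?B)"
  proof safe
    fix q assume q: "q \<in> {1..n}" "primepow q" "real (aprimedivisor q) \<le> y"
    then obtain p k where pk: "prime p" "k > 0" "q = p ^ k" by (auto simp: primepow_def)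
    then have "aprimedivisor q = p" by (simp add: aprimedivisor_prime_power)
    then have p: "p \<in> ?A" using q(3) pk(1) prime_gt_0_nat[of p] by (auto simp: le_nat_floor)
    have "(2::nat) ^ k \<le> p ^ k" using pk(1) prime_ge_2_nat[of p] by (intro power_mono) auto
    then have "real (2 ^ k) \<le> real n" using q(1) pk(3) by (subst of_nat_le_iff) simp
    then have "ln (2 ^ k) \<le> ln (real n)" using assms(1) by simp
    then have "real k \<le> ln (real n) / ln 2" by (simp add: ln_realpow field_simps)
    then have "k \<in> ?B" using pk(2) by (auto simp: le_nat_floor)
    then show "q \<in> (\<lambda>(p, k). p ^ k) ` (?A \<times> ?B)" using p pk(3) by auto
  qed
  then have "card {q\<in>{1..n}. primepow q \<and> real (aprimedivisor q) \<le> y} \<le> card (?A \<times> ?B)"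
    by (intro surj_card_le) simp
  then have "real (card {q\<in>{1..n}. primepow q \<and> real (aprimedivisor q) \<le> y}) \<le> real (card (?A \<times> ?B))"
    by (rule of_nat_mono)
  also have "\<dots> = real (nat \<lfloor>y\<rfloor>) * real (nat \<lfloor>ln (real n) / ln 2\<rfloor>)" by (simp add: card_cartesian_product)
  also have "\<dots> \<le> y * (ln (real n) / ln 2)"
    using assms by (intro mult_mono of_nat_floor) (auto simp: of_nat_floor)
  finally show ?thesis .
qed

text \<open>
  In the identity \<open>ln b = (\<Sum>q | q dvd b. mangoldt q)\<close>, each of the prime powers counted
  contributes more than \<open>ln y\<close>.
\<close>

lemma card_large_primepow_divisors_le:
  fixes b :: nat and y :: real
  assumes "b \<ge> 1" "y > 1"
  shows "real (card {q. primepow q \<and> y < real (aprimedivisor q) \<and> q dvd b}) \<le> ln (real b) / ln y"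
proof -
  let ?S = "{q. primepow q \<and> y < real (aprimedivisor q) \<and> q dvd b}"
  have fin: "finite {d. d dvd b}" using assms(1) by simp
  have "real (card ?S) * ln y = (\<Sum>q\<in>?S. ln y)" by simp
  also have "\<dots> \<le> (\<Sum>q\<in>?S. mangoldt q)"
    by (rule sum_mono) (use assms(2) in \<open>auto simp: mangoldt_def\<close>)
  also have "\<dots> \<le> (\<Sum>q | q dvd b. mangoldt q)"
    by (rule sum_mono2[OF fin]) (auto simp: mangoldt_nonneg)
  also have "\<dots> = ln (real b)" using mangoldt_sum[of b, where ?'a = real] assms(1) by simp
  finally show ?thesis using assms(2) by (simp add: field_simps)
qed

text \<open>
  A number \<open>a\<close> is mapped to the small prime powers dividing it, together with the pairs \<open>(i, c)\<close>
  such that the \<open>i\<close>-th colouring gives the colour \<open>c\<close> to a large prime power dividing \<open>a\<close>. This is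
  monotone for any colourings; it reflects divisibility because the colourings separate every
  large prime power \<open>q\<close> from the set \<open>S b\<close> whenever \<open>q\<close> does not divide \<open>b\<close>.
\<close>

lemma two_dim_divisibility_le:
  fixes n r t :: nat and y :: real
  assumes "n \<ge> 1" "y > 1" "r \<ge> 1" "ln (real n) / ln y < real r + 1" "n ^ 2 < 2 ^ t"
  shows "two_dim {1..n} ((dvd) :: nat \<Rightarrow> nat \<Rightarrow> bool)
    \<le> card {q\<in>{1..n}. primepow q \<and> real (aprimedivisor q) \<le> y} + t * (2 * r)"
proof -
  define P where "P = {q\<in>{1..n}. primepow q \<and> real (aprimedivisor q) \<le> y}"
  define Q where "Q = {q\<in>{1..n}. primepow q \<and> y < real (aprimedivisor q)}"
  define S where "S b = {q\<in>Q. q dvd b}" for b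
  define X where "X = {(q, S b) | q b. q \<in> Q \<and> b \<in> {1..n} \<and> \<not> q dvd b}"
  have finPQ: "finite P" "finite Q" unfolding P_def Q_def by auto
  have Xsub: "X \<subseteq> (\<lambda>(q, b). (q, S b)) ` ({1..n} \<times> {1..n})" unfolding X_def Q_def by auto
  have finX: "finite X" using Xsub by (rule finite_subset) simp
  have "card X \<le> card ({1..n} \<times> {1..n})" using Xsub by (rule surj_card_le[rotated]) simp
  then have cardX: "card X < 2 ^ t" using assms(5) by (simp add: card_cartesian_product power2_eq_square)
  have cardS: "card (S b) \<le> r" if "b \<in> {1..n}" for b
  proof -
    have "S b = {q. primepow q \<and> y < real (aprimedivisor q) \<and> q dvd b}"
      unfolding S_def Q_def using that by (auto dest: dvd_imp_le primepow_gt_0_nat simp: Suc_le_eq)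
    then have "real (card (S b)) \<le> ln (real b) / ln y"
      using card_large_primepow_divisors_le[of b y] that assms(2) by simp
    also have "\<dots> \<le> ln (real n) / ln y" using that assms(2) by (intro divide_right_mono) auto
    finally show ?thesis using assms(4) by simp
  qed
  have "\<exists>g. (\<forall>i<t. g i \<in> Q \<rightarrow> {..<2 * r}) \<and> (\<forall>(q, S)\<in>X. \<exists>i<t. g i q \<notin> g i ` S)"
    by (rule exists_separating_colourings[OF finPQ(2) finX cardX assms(3)])
      (use cardS in \<open>auto simp: X_def S_def\<close>)
  then obtain g where range: "\<forall>i<t. g i \<in> Q \<rightarrow> {..<2 * r}"
    and sep: "\<forall>(q, S)\<in>X. \<exists>i<t. g i q \<notin> g i ` S" by (elim exE conjE)
  have separated: "\<exists>i<t. g i q \<notin> g i ` S b" if "q \<in> Q" "b \<in> {1..n}" "\<not> q dvd b" for q b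
  proof -
    have "(q, S b) \<in> X" unfolding X_def using that by blast
    then show ?thesis using bspec[OF sep] by auto
  qed
  define I where "I = Inl ` P \<union> Inr ` ({..<t} \<times> {..<2 * r})"
  define \<psi> where "\<psi> a = Inl ` {q\<in>P. q dvd a} \<union> Inr ` {(i, g i q) | i q. i < t \<and> q \<in> S a}" for a
  have "poset_embedding {1..n} ((dvd) :: nat \<Rightarrow> nat \<Rightarrow> bool) (Pow I) (\<subseteq>) \<psi>"
    unfolding poset_embedding_def
  proof (intro conjI ballI iffI)
    show "\<psi> ` {1..n} \<subseteq> Pow I" unfolding \<psi>_def I_def S_def using range by (auto simp: Pi_iff)
  next
    fix a b :: nat assume "a dvd b"
    then have "{q\<in>P. q dvd a} \<subseteq> {q\<in>P. q dvd b}" "S a \<subseteq> S b"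
      unfolding S_def by (auto intro: dvd_trans)
    then show "\<psi> a \<subseteq> \<psi> b" unfolding \<psi>_def by (intro Un_mono image_mono) blast+
  next
    fix a b :: nat assume ab: "a \<in> {1..n}" "b \<in> {1..n}" and sub: "\<psi> a \<subseteq> \<psi> b"
    have "q dvd b" if q: "primepow q" "q dvd a" for q
    proof (cases "real (aprimedivisor q) \<le> y")
      case True
      then have "q \<in> P" unfolding P_def using q ab(1) by (auto dest: dvd_imp_le primepow_gt_0_nat simp: Suc_le_eq)
      then have "Inl q \<in> \<psi> a" using q unfolding \<psi>_def by auto
      then show ?thesis using sub unfolding \<psi>_def by auto
    next
      case False
      then have Q: "q \<in> Q" unfolding Q_def using q ab(1) by (auto dest: dvd_imp_le primepow_gt_0_nat simp: Suc_le_eq)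
      show ?thesis
      proof (rule ccontr)
        assume "\<not> q dvd b"
        then obtain i where i: "i < t" "g i q \<notin> g i ` S b" using separated[OF Q ab(2)] by blast
        have "q \<in> S a" using Q q(2) unfolding S_def by simp
        then have "(i, g i q) \<in> {(i, g i q) | i q. i < t \<and> q \<in> S a}" using i(1) by blast
        then have "Inr (i, g i q) \<in> \<psi> a" unfolding \<psi>_def by (intro UnI2 imageI)
        then have "Inr (i, g i q) \<in> \<psi> b" using sub by blast
        then have "(i, g i q) \<in> {(i, g i q) | i q. i < t \<and> q \<in> S b}" unfolding \<psi>_def by auto
        then show False using i(2) by auto
      qed
    qed
    then show "a dvd b" using ab dvd_iff_primepow_dvd[of a b] by simp
  qed
  then have "two_dim {1..n} ((dvd) :: nat \<Rightarrow> nat \<Rightarrow> bool) \<le> card I"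
    by (rule two_dim_le_card[rotated]) (simp add: I_def finPQ)
  also have "\<dots> \<le> card P + t * (2 * r)"
    unfolding I_def by (rule order_trans[OF card_Un_le]) (simp add: card_image card_cartesian_product)
  finally show ?thesis unfolding P_def .
qed

section \<open>Asymptotics\<close>

lemma ln_4_ge_1: "1 \<le> ln (4::real)"
  using exp_le by (subst ln_ge_iff) auto

text \<open>
  The primes up to \<open>L\<^sup>2\<close> are used, with \<open>L = ln n\<close>: this is large enough for their number to
  exceed the required bound, while \<open>r = L / (2 ln L)\<close> of them still have a product at most \<open>n\<close>.
  The even number \<open>2 m\<close> approximates \<open>L\<^sup>2\<close> from below.
\<close>

lemma two_dim_divisibility_asymp_ge:
  "\<forall>\<^sub>F n in sequentially. 1 / 16 * ((ln (real n))\<^sup>2 / (ln (ln (real n)))\<^sup>2)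
     \<le> real (two_dim {1..n} ((dvd) :: nat \<Rightarrow> nat \<Rightarrow> bool))"
proof -
  have "\<forall>\<^sub>F n in sequentially. ln (real n) > 3 \<and> ln (ln (real n)) > 1 \<and> (ln (real n))\<^sup>2 \<le> real n \<and>
    (1 / 16 * ((ln (real n))\<^sup>2 / (ln (ln (real n)))\<^sup>2) + 1) * (2 * ln (ln (real n)))
      \<le> ((ln (real n))\<^sup>2 / 2 - 1) * 1"
    by (intro eventually_conj; real_asymp)
  then show ?thesis
  proof (rule eventually_mono, safe)
    fix n :: nat
    define L where "L = ln (real n)"
    assume "ln (real n) > 3" "ln (ln (real n)) > 1" "(ln (real n))\<^sup>2 \<le> real n"
      "(1 / 16 * ((ln (real n))\<^sup>2 / (ln (ln (real n)))\<^sup>2) + 1) * (2 * ln (ln (real n)))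
      \<le> ((ln (real n))\<^sup>2 / 2 - 1) * 1"
    then have L: "L > 3" "ln L > 1" "L\<^sup>2 \<le> real n"
      and main: "(1 / 16 * (L\<^sup>2 / (ln L)\<^sup>2) + 1) * (2 * ln L) \<le> (L\<^sup>2 / 2 - 1) * 1"
      by (simp_all add: L_def)
    have n: "real n > 0" using L(1) by (cases n) (auto simp: L_def)
    define m where "m = nat \<lfloor>L\<^sup>2 / 2\<rfloor>"
    define r where "r = nat \<lfloor>L / (2 * ln L)\<rfloor>"
    have "L\<^sup>2 > 3\<^sup>2" using L(1) by (intro power_strict_mono) auto
    then have "L\<^sup>2 > 9" by simp
    then have m: "real m \<le> L\<^sup>2 / 2" "L\<^sup>2 / 2 - 1 < real m" "m \<ge> 1"
      unfolding m_def by linarith+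
    have r0: "L / (2 * ln L) \<ge> 0" using L by simp
    then have r: "real r \<le> L / (2 * ln L)" "L / (2 * ln L) < real r + 1" unfolding r_def by linarith+
    have ln2m: "ln (real (2 * m)) \<le> 2 * ln L"
    proof -
      have "ln (real (2 * m)) \<le> ln (L\<^sup>2)" using m by (subst ln_le_cancel_iff) auto
      then show ?thesis using L by (simp add: ln_realpow)
    qed
    have "(2 * m) ^ r \<le> n"
    proof -
      have "real r * ln (real (2 * m)) \<le> real r * (2 * ln L)" using ln2m by (rule mult_left_mono) simp
      also have "\<dots> \<le> L" using r(1) L by (simp add: field_simps)
      finally have "ln (real (2 * m) ^ r) \<le> ln (real n)" using m(3) by (subst ln_realpow) (auto simp: L_def)
      then have "real (2 * m) ^ r \<le> real n" using m(3) n by (subst (asm) ln_le_cancel_iff) auto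
      then show ?thesis by (metis of_nat_le_iff of_nat_power)
    qed
    moreover have "2 * m \<le> n"
    proof -
      have "real (2 * m) \<le> real n" using m(1) L(3) by simp
      then show ?thesis by simp
    qed
    ultimately have "min (card {p. prime p \<and> p \<le> 2 * m}) ((r + 2) choose 2)
      \<le> two_dim {1..n} ((dvd) :: nat \<Rightarrow> nat \<Rightarrow> bool)" (is "min ?\<pi> ?c \<le> ?d")
      by (rule two_dim_divisibility_ge)
    then have "min (real ?\<pi>) (real ?c) \<le> real ?d" by linarith
    moreover have "1 / 16 * (L\<^sup>2 / (ln L)\<^sup>2) \<le> real ?\<pi>"
    proof -
      have "(1 / 16 * (L\<^sup>2 / (ln L)\<^sup>2) + 1) * (2 * ln L) \<le> real m * 1" using main m by simp
      also have "\<dots> \<le> real m * ln 4"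
        using ln_4_ge_1 by (rule mult_left_mono) simp
      also have "\<dots> \<le> (real ?\<pi> + 1) * ln (real (2 * m))" by (rule card_primes_ge[OF m(3)])
      also have "\<dots> \<le> (real ?\<pi> + 1) * (2 * ln L)" using ln2m by (rule mult_left_mono) simp
      finally show ?thesis using L(2) by simp
    qed
    moreover have "1 / 16 * (L\<^sup>2 / (ln L)\<^sup>2) \<le> real ?c"
    proof -
      have "2 * ?c = (r + 2) * (r + 1)" by (simp add: choose_two)
      then have "real (2 * ?c) = real ((r + 2) * (r + 1))" by (rule arg_cong)
      then have c: "2 * real ?c = (real r + 2) * (real r + 1)"
        unfolding of_nat_mult of_nat_add by simp
      have "(L / (2 * ln L))\<^sup>2 \<le> (real r + 1)\<^sup>2" using r r0 by (intro power_mono) auto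
      also have "\<dots> \<le> 2 * real ?c" unfolding c by (simp add: power2_eq_square)
      finally have "L\<^sup>2 / (ln L)\<^sup>2 / 4 \<le> 2 * real ?c" by (simp add: power_divide power_mult_distrib)
      moreover have "1 / 16 * u \<le> v" if "u / 4 \<le> 2 * v" "u \<ge> 0" for u v :: real
        using that by simp
      ultimately show ?thesis by simp
    qed
    ultimately show "1 / 16 * ((ln (real n))\<^sup>2 / (ln (ln (real n)))\<^sup>2) \<le> real ?d"
      unfolding L_def by linarith
  qed
qed

text \<open>
  The threshold \<open>y = sqrt L\<close> makes the small prime powers negligible, of order \<open>L powr (3/2)\<close>, and
  still satisfies \<open>ln y = ln L / 2\<close>. Bounding \<open>ln 2\<close> below by \<open>1/2\<close> turns the leading
  constant \<open>8 / ln 2\<close> into \<open>16\<close>, which is below \<open>24\<close>.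
\<close>

lemma two_dim_divisibility_asymp_le:
  "\<forall>\<^sub>F n in sequentially. real (two_dim {1..n} ((dvd) :: nat \<Rightarrow> nat \<Rightarrow> bool))
     \<le> 24 * ((ln (real n))\<^sup>2 / ln (ln (real n)))"
proof -
  have "\<forall>\<^sub>F n in sequentially. ln (real n) > 1 \<and> ln (ln (real n)) > 0 \<and>
    2 * ln (real n) / ln (ln (real n)) \<ge> 1 \<and>
    sqrt (ln (real n)) * (2 * ln (real n)) +
      (4 * ln (real n) + 1) * (2 * (2 * ln (real n) / ln (ln (real n))))
      \<le> 24 * ((ln (real n))\<^sup>2 / ln (ln (real n)))"
    by (intro eventually_conj; real_asymp)
  then show ?thesis
  proof (rule eventually_mono, safe)
    fix n :: nat
    define L where "L = ln (real n)"
    assume "ln (real n) > 1" "ln (ln (real n)) > 0" "2 * ln (real n) / ln (ln (real n)) \<ge> 1"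
      "sqrt (ln (real n)) * (2 * ln (real n)) +
      (4 * ln (real n) + 1) * (2 * (2 * ln (real n) / ln (ln (real n))))
      \<le> 24 * ((ln (real n))\<^sup>2 / ln (ln (real n)))"
    then have L: "L > 1" "ln L > 0" "2 * L / ln L \<ge> 1"
      and main: "sqrt L * (2 * L) + (4 * L + 1) * (2 * (2 * L / ln L)) \<le> 24 * (L\<^sup>2 / ln L)"
      by (simp_all add: L_def)
    have n: "n \<ge> 1" using L(1) unfolding L_def by (cases n) auto
    have ln2: "ln (2::real) \<ge> 1 / 2" using ln_4_ge_1 ln_realpow[of 2 2] by simp
    have Lln2: "L / ln 2 \<le> 2 * L" using ln2 L(1) mult_left_mono[OF ln2, of "2 * L"] by (simp add: field_simps)
    define r where "r = nat \<lfloor>2 * L / ln L\<rfloor>"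
    define t where "t = nat \<lfloor>2 * L / ln 2\<rfloor> + 1"
    have r: "real r \<le> 2 * L / ln L" "2 * L / ln L < real r + 1" "r \<ge> 1"
      using L(3) unfolding r_def by linarith+
    have t: "real t \<le> 4 * L + 1" "2 * L / ln 2 < real t"
    proof -
      have "2 * L / ln 2 \<ge> 0" using L(1) by simp
      then have "real t \<le> 2 * L / ln 2 + 1" "2 * L / ln 2 < real t" unfolding t_def by linarith+
      then show "real t \<le> 4 * L + 1" "2 * L / ln 2 < real t" using Lln2 by simp_all
    qed
    have n2: "n ^ 2 < 2 ^ t"
    proof -
      have "ln (real n ^ 2) < ln (2 ^ t)" using t(2) n by (simp add: ln_realpow L_def field_simps)
      then have "real n ^ 2 < 2 ^ t" using n by (subst (asm) ln_less_cancel_iff) auto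
      then show ?thesis by (metis of_nat_less_iff of_nat_numeral of_nat_power)
    qed
    have sq: "sqrt L > 1" "ln (sqrt L) = ln L / 2" using L(1) by (simp_all add: ln_sqrt)
    have "ln (real n) / ln (sqrt L) < real r + 1" using r(2) unfolding sq(2) L_def[symmetric] by (simp add: mult.commute)
    from of_nat_mono[OF two_dim_divisibility_le[OF n sq(1) r(3) this n2], where ?'a = real]
    have "real (two_dim {1..n} ((dvd) :: nat \<Rightarrow> nat \<Rightarrow> bool))
      \<le> real (card {q\<in>{1..n}. primepow q \<and> real (aprimedivisor q) \<le> sqrt L}) + real t * (2 * real r)"
      by simp
    also have "\<dots> \<le> sqrt L * (L / ln 2) + (4 * L + 1) * (2 * (2 * L / ln L))"
      using card_small_primepow_le[OF n, of "sqrt L"] L t(1) r(1)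
      by (intro add_mono mult_mono) (auto simp: L_def)
    also have "\<dots> \<le> sqrt L * (2 * L) + (4 * L + 1) * (2 * (2 * L / ln L))"
      using Lln2 L(1) by (intro add_right_mono mult_left_mono) auto
    also note main
    finally show "real (two_dim {1..n} ((dvd) :: nat \<Rightarrow> nat \<Rightarrow> bool)) \<le> 24 * ((ln (real n))\<^sup>2 / ln (ln (real n)))"
      by (simp add: L_def)
  qed
qed

theorem theorem1p2:
  shows "\<exists>\<epsilon> \<delta> :: nat \<Rightarrow> real. \<epsilon> \<longlonglongrightarrow> 0 \<and> \<delta> \<longlonglongrightarrow> 0 \<and>
    (\<forall>\<^sub>F n in sequentially.
       (1 / 16 - \<epsilon> n) * ((ln (real n))\<^sup>2 / (ln (ln (real n)))\<^sup>2)
         \<le> real (two_dim {1..n} ((dvd) :: nat \<Rightarrow> nat \<Rightarrow> bool)) \<and>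
       real (two_dim {1..n} ((dvd) :: nat \<Rightarrow> nat \<Rightarrow> bool))
         \<le> (4 / 3 * exp 1 * pi\<^sup>2 + \<delta> n) * ((ln (real n))\<^sup>2 / ln (ln (real n))))"
proof -
  have "exp (1::real) \<ge> 2" using exp_ge_add_one_self[of 1] by simp
  \<comment> \<open>\<open>sin (pi / 6) = 1 / 2\<close> is at most \<open>pi / 6\<close>\<close>
  moreover have "pi \<ge> 3" using sin_x_le_x[of "pi / 6"] sin_30 by simp
  then have "pi\<^sup>2 \<ge> 3\<^sup>2" by (intro power_mono) auto
  ultimately have "exp 1 * pi\<^sup>2 \<ge> 2 * 3\<^sup>2" by (intro mult_mono) auto
  then have const: "24 \<le> 4 / 3 * exp 1 * pi\<^sup>2" by simp
  have "\<forall>\<^sub>F n in sequentially. ln (ln (real n)) > 0" by real_asymp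
  then have "\<forall>\<^sub>F n in sequentially.
       (1 / 16 - 0) * ((ln (real n))\<^sup>2 / (ln (ln (real n)))\<^sup>2)
         \<le> real (two_dim {1..n} ((dvd) :: nat \<Rightarrow> nat \<Rightarrow> bool)) \<and>
       real (two_dim {1..n} ((dvd) :: nat \<Rightarrow> nat \<Rightarrow> bool))
         \<le> (4 / 3 * exp 1 * pi\<^sup>2 + 0) * ((ln (real n))\<^sup>2 / ln (ln (real n)))"
    using two_dim_divisibility_asymp_ge two_dim_divisibility_asymp_le
  proof eventually_elim
    case (elim n)
    have "24 * ((ln (real n))\<^sup>2 / ln (ln (real n))) \<le> 4 / 3 * exp 1 * pi\<^sup>2 * ((ln (real n))\<^sup>2 / ln (ln (real n)))"
      using const elim(1) by (intro mult_right_mono) auto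
    then show ?case using elim by simp
  qed
  then show ?thesis by (intro exI[of _ "\<lambda>_. 0"]) simp
qed

end
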